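(* Let $\alpha: I\to E_1^3$ be a non-lightlike curve and let $\beta$ be a non-lightlike Bertrand-direction curve of $\alpha$. Then the following are equivalent: (i) $\alpha$ is a slant helix. (ii) $\alpha$ is a Bertrand-donor curve of a slant helix. (iii) A Bertrand-direction curve of $\alpha$ is a slant helix.
   Context: $E_1^3$ is $\mathbb{R}^3$ with the metric $\langle x,y\rangle=-x_1y_1+x_2y_2+x_3y_3$ and the Lorentz vector product $x\times y=(x_2y_3-x_3y_2,\ x_1y_3-x_3y_1,\ x_2y_1-x_1y_2)$. A vector $x$ is spacelike if $\langle x,x\rangle>0$ or $x=0$, timelike if $\langle x,x\rangle<0$, lightlike if $\langle x,x\rangle=0$ and $x\ne0$. A curve is timelike (spacelike) if all its velocity vectors are; non-lightlike means timelike or spacelike; unit speed means $|\langle\alpha',\alpha'\rangle|=1$. All curves are unit speed Frenet curves, as differentiable as needed. A unit speed non-lightlike curve $\alpha(s)$ has Frenet frame $\{T,N,B\}$ (orthonormal, non-lightlike vectors, $T=\alpha'$), curvature $\kappa$ and torsion $\tau$ with $T'=\kappa N,\ N'=\varepsilon_B\kappa T+\tau B,\ B'=\varepsilon_T\tau N$, where $\varepsilon_Y=\langle Y,Y\rangle=\pm1$ and $\varepsilon_B=-\varepsilon_T\varepsilon_N$; the frame satisfies $B=\varepsilon_T\varepsilon_N T\times N$, $N=\varepsilon_B\varepsilon_T B\times T$, $T=\varepsilon_N\varepsilon_B N\times B$. It is a Frenet curve if $\kappa\neq0$. A spacelike curve is of type 1 if $N$ is timelike (and $T,B$ spacelike),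 of type 2 if $B$ is timelike (and $T,N$ spacelike). Let $X=uT+vN+wB$ with $u,v,w$ differentiable and $\varepsilon_Tu^2+\varepsilon_Nv^2+\varepsilon_Bw^2=\pm1$ (constant sign). An $X$-direction curve of $\alpha$ is a curve $\beta$ with tangent $\overline T=X$; $s$ is also arc-length for $\beta$. The Frenet frame, curvature and torsion of $\beta$ are $\{\overline T,\overline N,\overline B\},\overline\kappa,\overline\tau$, with $\overline\kappa\ne0$. $\beta$ is a Bertrand-direction curve of $\alpha$, and $\alpha$ a Bertrand-donor curve of $\beta$, if $\beta$ is an $X$-direction curve of $\alpha$ and a Bertrand curve of $\alpha$ with $\alpha$ its Bertrand partner curve (i.e. $\overline N=N$); explicitly, for a constant $\theta$, $X$ is: $\cosh\theta\,T+\sinh\theta\,B$ if $\alpha$ is timelike (resp. spacelike of type 2) and $X$ timelike (resp. spacelike); $\sinh\theta\,T+\cosh\theta\,B$ if $\alpha$ is timelike (resp. spacelike of type 2) and $X$ spacelike (resp. timelike); $\cos\theta\,T+\sin\theta\,B$ if $\alpha$ is spacelike of type 1 and $X$ spacelike. A slant helix is a curve whose principal normal vectors make a constant angle with a fixed line (i.e. $\langle N,U\rangle$ is constant for some fixed vector $U\neq0$); the characterization used is that $\frac{\kappa^2}{(\tau^2-\kappa^2)^{3/2}}\left(\frac{\tau}{\kappa}\right)'$ or $\frac{\kappa^2}{(\kappa^2\pm\tau^2)^{3/2}}\left(\frac{\tau}{\kappa}\right)'$ is constant. *)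

theory Defs
  imports "HOL-Analysis.Analysis"
begin

definition lorentz_inner :: "real^3 \<Rightarrow> real^3 \<Rightarrow> real" where
  "lorentz_inner x y = - (x$1 * y$1) + x$2 * y$2 + x$3 * y$3"

definition lorentz_cross :: "real^3 \<Rightarrow> real^3 \<Rightarrow> real^3" where
  "lorentz_cross x y =
     vector [x$2 * y$3 - x$3 * y$2, x$1 * y$3 - x$3 * y$1, x$2 * y$1 - x$1 * y$2]"

definition spacelike :: "real^3 \<Rightarrow> bool" where
  "spacelike x \<longleftrightarrow> lorentz_inner x x > 0 \<or> x = 0"

definition timelike :: "real^3 \<Rightarrow> bool" where
  "timelike x \<longleftrightarrow> lorentz_inner x x < 0"

text \<open>Derivatives are taken within the parameter interval, so that an interval may contain
  its end points (one-sided derivatives there).\<close>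

definition velocity :: "real set \<Rightarrow> (real \<Rightarrow> real^3) \<Rightarrow> real \<Rightarrow> real^3" where
  "velocity I \<alpha> s = vector_derivative \<alpha> (at s within I)"

definition timelike_curve :: "real set \<Rightarrow> (real \<Rightarrow> real^3) \<Rightarrow> bool" where
  "timelike_curve I \<alpha> \<longleftrightarrow> \<alpha> differentiable_on I \<and> (\<forall>s\<in>I. timelike (velocity I \<alpha> s))"

definition spacelike_curve :: "real set \<Rightarrow> (real \<Rightarrow> real^3) \<Rightarrow> bool" where
  "spacelike_curve I \<alpha> \<longleftrightarrow> \<alpha> differentiable_on I \<and> (\<forall>s\<in>I. spacelike (velocity I \<alpha> s))"

definition nonlightlike_curve :: "real set \<Rightarrow> (real \<Rightarrow> real^3) \<Rightarrow> bool" where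
  "nonlightlike_curve I \<alpha> \<longleftrightarrow> timelike_curve I \<alpha> \<or> spacelike_curve I \<alpha>"

definition unit_speed :: "real set \<Rightarrow> (real \<Rightarrow> real^3) \<Rightarrow> bool" where
  "unit_speed I \<alpha> \<longleftrightarrow>
     (\<forall>s\<in>I. \<bar>lorentz_inner (velocity I \<alpha> s) (velocity I \<alpha> s)\<bar> = 1)"

definition caus_sign :: "real^3 \<Rightarrow> real" where
  "caus_sign y = lorentz_inner y y"

text \<open>The curve is a unit speed non-lightlike Frenet curve with Frenet frame \<open>T, N, B\<close>, curvature
  \<open>\<kappa>\<close> and torsion \<open>\<tau>\<close>. The curvature is only required to be nonzero, so on an interval
  \<open>N\<close> (and with it \<open>B\<close> and \<open>\<kappa>\<close>) is determined up to one global sign. The signs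
  \<open>caus_sign (T s)\<close> etc. are constant on an interval because the frame is continuous.\<close>

definition frenet_apparatus ::
  "real set \<Rightarrow> (real \<Rightarrow> real^3) \<Rightarrow> (real \<Rightarrow> real^3) \<Rightarrow> (real \<Rightarrow> real^3) \<Rightarrow> (real \<Rightarrow> real^3)
    \<Rightarrow> (real \<Rightarrow> real) \<Rightarrow> (real \<Rightarrow> real) \<Rightarrow> bool" where
  "frenet_apparatus I \<alpha> T N B \<kappa> \<tau> \<longleftrightarrow>
     nonlightlike_curve I \<alpha> \<and> unit_speed I \<alpha> \<and>
     (\<forall>s\<in>I.
        \<bar>caus_sign (T s)\<bar> = 1 \<and> \<bar>caus_sign (N s)\<bar> = 1 \<and> \<bar>caus_sign (B s)\<bar> = 1 \<and>
        caus_sign (B s) = - (caus_sign (T s) * caus_sign (N s)) \<and>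
        lorentz_inner (T s) (N s) = 0 \<and> lorentz_inner (N s) (B s) = 0 \<and>
        lorentz_inner (B s) (T s) = 0 \<and>
        B s = (caus_sign (T s) * caus_sign (N s)) *\<^sub>R lorentz_cross (T s) (N s) \<and>
        N s = (caus_sign (B s) * caus_sign (T s)) *\<^sub>R lorentz_cross (B s) (T s) \<and>
        T s = (caus_sign (N s) * caus_sign (B s)) *\<^sub>R lorentz_cross (N s) (B s) \<and>
        (\<alpha> has_vector_derivative T s) (at s within I) \<and>
        (T has_vector_derivative \<kappa> s *\<^sub>R N s) (at s within I) \<and>
        (N has_vector_derivative (caus_sign (B s) * \<kappa> s) *\<^sub>R T s + \<tau> s *\<^sub>R B s) (at s within I) \<and>
        (B has_vector_derivative (caus_sign (T s) * \<tau> s) *\<^sub>R N s) (at s within I) \<and>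
        \<kappa> s \<noteq> 0)"

definition frenet_curve :: "real set \<Rightarrow> (real \<Rightarrow> real^3) \<Rightarrow> bool" where
  "frenet_curve I \<alpha> \<longleftrightarrow> (\<exists>T N B \<kappa> \<tau>. frenet_apparatus I \<alpha> T N B \<kappa> \<tau>)"

text \<open>\<open>\<beta>\<close> is an \<open>X\<close>-direction curve of a curve with Frenet frame \<open>T, N, B\<close>.\<close>

definition direction_curve ::
  "real set \<Rightarrow> (real \<Rightarrow> real^3) \<Rightarrow> (real \<Rightarrow> real^3) \<Rightarrow> (real \<Rightarrow> real^3)
    \<Rightarrow> (real \<Rightarrow> real^3) \<Rightarrow> (real \<Rightarrow> real^3) \<Rightarrow> bool" where
  "direction_curve I T N B X \<beta> \<longleftrightarrow>
     (\<exists>u v w :: real \<Rightarrow> real.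
        u differentiable_on I \<and> v differentiable_on I \<and> w differentiable_on I \<and>
        (\<forall>s\<in>I. X s = u s *\<^sub>R T s + v s *\<^sub>R N s + w s *\<^sub>R B s) \<and>
        (\<exists>e\<in>{1, -1}. \<forall>s\<in>I. caus_sign (T s) * (u s)\<^sup>2 + caus_sign (N s) * (v s)\<^sup>2
                             + caus_sign (B s) * (w s)\<^sup>2 = e)) \<and>
     (\<forall>s\<in>I. (\<beta> has_vector_derivative X s) (at s within I))"

text \<open>\<open>\<beta>\<close> is a Bertrand-direction curve of \<open>\<alpha>\<close>: an \<open>X\<close>-direction curve with the same principal
  normal. That \<open>X = u T + w B\<close> with constant \<open>u\<close>, \<open>w\<close> (so, up to sign,
  \<open>X = cosh \<theta> T + sinh \<theta> B\<close> etc. with constant \<open>\<theta>\<close>) is a consequence.\<close>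

definition bertrand_direction_curve ::
  "real set \<Rightarrow> (real \<Rightarrow> real^3) \<Rightarrow> (real \<Rightarrow> real^3) \<Rightarrow> bool" where
  "bertrand_direction_curve I \<alpha> \<beta> \<longleftrightarrow>
     (\<exists>T N B \<kappa> \<tau> X T' N' B' \<kappa>' \<tau>'.
        frenet_apparatus I \<alpha> T N B \<kappa> \<tau> \<and> direction_curve I T N B X \<beta> \<and>
        frenet_apparatus I \<beta> T' N' B' \<kappa>' \<tau>' \<and> (\<forall>s\<in>I. N' s = N s))"

definition bertrand_donor_curve ::
  "real set \<Rightarrow> (real \<Rightarrow> real^3) \<Rightarrow> (real \<Rightarrow> real^3) \<Rightarrow> bool" where
  "bertrand_donor_curve I \<beta> \<alpha> \<longleftrightarrow> bertrand_direction_curve I \<alpha> \<beta>"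

definition slant_helix :: "real set \<Rightarrow> (real \<Rightarrow> real^3) \<Rightarrow> bool" where
  "slant_helix I \<alpha> \<longleftrightarrow>
     (\<exists>T N B \<kappa> \<tau>. frenet_apparatus I \<alpha> T N B \<kappa> \<tau> \<and>
        (\<exists>U c. U \<noteq> 0 \<and> (\<forall>s\<in>I. lorentz_inner (N s) U = c)))"

end

(* A unit speed Frenet curve determines its principal normal up to one global sign: T is the
   derivative of the curve, so two frames share T and hence the vector field kappa N; the two
   unit normals then differ by a factor +-1, which is continuous and therefore constant on the
   interval. So whether N makes a constant angle with a fixed direction does not depend on the
   frame, and Bertrand-direction curves share the principal normal of the original curve. *)

theory Submission
  imports Defs
begin

lemma lorentz_inner_scaleR_left: "lorentz_inner (c *\<^sub>R x) y = c * lorentz_inner x y"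
  by (simp add: lorentz_inner_def algebra_simps)

lemma lorentz_inner_scaleR_right: "lorentz_inner x (c *\<^sub>R y) = c * lorentz_inner x y"
  by (simp add: lorentz_inner_def algebra_simps)

lemma continuous_on_lorentz_inner:
  assumes "continuous_on S f" "continuous_on S g"
  shows "continuous_on S (\<lambda>s. lorentz_inner (f s) (g s))"
  unfolding lorentz_inner_def by (intro continuous_intros assms)

text \<open>A connected set with more than one point has no isolated points. This is what makes
  derivatives within \<open>I\<close> unique, end points included.\<close>

lemma interval_at_within_nontrivial:
  fixes I :: "real set"
  assumes "is_interval I" "interior I \<noteq> {}" "s \<in> I"
  shows "at s within I \<noteq> bot"
proof -
  have "I \<noteq> {s}"
    using assms(2) by auto
  then have "s islimpt I"
    using assms connected_imp_perfect is_interval_connected by blast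
  then show ?thesis
    by (simp add: trivial_limit_within)
qed

lemma frenet_apparatusD:
  assumes "frenet_apparatus I \<alpha> T N B \<kappa> \<tau>" "s \<in> I"
  shows "(\<alpha> has_vector_derivative T s) (at s within I)"
    and "(T has_vector_derivative \<kappa> s *\<^sub>R N s) (at s within I)"
    and "(N has_vector_derivative (caus_sign (B s) * \<kappa> s) *\<^sub>R T s + \<tau> s *\<^sub>R B s) (at s within I)"
    and "\<bar>lorentz_inner (N s) (N s)\<bar> = 1"
    and "\<kappa> s \<noteq> 0"
  using assms unfolding frenet_apparatus_def caus_sign_def by blast+

lemma frenet_apparatus_normal_continuous_on:
  assumes "frenet_apparatus I \<alpha> T N B \<kappa> \<tau>"
  shows "continuous_on I N"
  unfolding continuous_on_eq_continuous_within
proof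
  show "continuous (at s within I) N" if "s \<in> I" for s
    using frenet_apparatusD(3)[OF assms that] by (rule has_vector_derivative_continuous)
qed

lemma frenet_apparatus_normal_unique:
  assumes I: "is_interval I" "interior I \<noteq> {}"
    and F1: "frenet_apparatus I \<alpha> T N B \<kappa> \<tau>"
    and F2: "frenet_apparatus I \<alpha> T' N' B' \<kappa>' \<tau>'"
  shows "\<exists>e. e\<^sup>2 = 1 \<and> (\<forall>s\<in>I. N' s = e *\<^sub>R N s)"
proof -
  \<comment> \<open>Since \<open>lorentz_inner (N s) (N s)\<close> is 1 or -1, multiplying by it
    amounts to dividing by it, so \<open>f s\<close> is the coefficient of \<open>N' s\<close> along
    \<open>N s\<close>. The closed formula makes continuity in \<open>s\<close> immediate, which a
    pointwise chosen coefficient would not.\<close>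
  define f where "f s = lorentz_inner (N' s) (N s) * lorentz_inner (N s) (N s)" for s
  have T: "T' s = T s" if "s \<in> I" for s
    by (rule vector_derivative_unique_within[OF interval_at_within_nontrivial[OF I that]
          frenet_apparatusD(1)[OF F2 that] frenet_apparatusD(1)[OF F1 that]])
  have f: "(f s)\<^sup>2 = 1 \<and> N' s = f s *\<^sub>R N s" if s: "s \<in> I" for s
  proof -
    have k: "\<kappa>' s \<noteq> 0" and n: "(lorentz_inner (N s) (N s))\<^sup>2 = 1"
      and n': "(lorentz_inner (N' s) (N' s))\<^sup>2 = 1"
      using frenet_apparatusD(4,5)[OF F1 s] frenet_apparatusD(4,5)[OF F2 s]
      by (simp_all add: abs_square_eq_1)
    have "(T has_vector_derivative \<kappa>' s *\<^sub>R N' s) (at s within I)"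
      using s T[symmetric] frenet_apparatusD(2)[OF F2 s] by (rule has_vector_derivative_transform)
    then have "\<kappa>' s *\<^sub>R N' s = \<kappa> s *\<^sub>R N s"
      using frenet_apparatusD(2)[OF F1 s]
      by (rule vector_derivative_unique_within[OF interval_at_within_nontrivial[OF I s]])
    then have "N' s = (\<kappa> s / \<kappa>' s) *\<^sub>R N s"
      using k by (metis divideR_right divide_inverse_commute scaleR_scaleR)
    then obtain c where c: "N' s = c *\<^sub>R N s" ..
    have fc: "f s = c"
      using n by (simp add: f_def c lorentz_inner_scaleR_left power2_eq_square mult.assoc)
    have "lorentz_inner (N' s) (N' s) = c\<^sup>2 * lorentz_inner (N s) (N s)"
      by (simp add: c lorentz_inner_scaleR_left lorentz_inner_scaleR_right power2_eq_square)
    \<comment> \<open>Only the absolute values of the two self-products are known to be 1, so the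
      equation is squared to remove their signs. A real \<open>c\<close> with fourth power 1 has
      square 1.\<close>
    then have "(c\<^sup>2)\<^sup>2 = 1"
      using n' n by (metis mult.right_neutral power_mult_distrib)
    then have "c\<^sup>2 = 1"
      unfolding power2_eq_1_iff[of "c\<^sup>2"] using zero_le_power2[of c] by linarith
    then show ?thesis
      using c fc by simp
  qed
  have "continuous_on I f"
    unfolding f_def
    by (intro continuous_on_mult continuous_on_lorentz_inner
        frenet_apparatus_normal_continuous_on[OF F1] frenet_apparatus_normal_continuous_on[OF F2])
  \<comment> \<open>A finite, nonempty, connected set of reals is a single point, so the sign cannot
    switch along \<open>I\<close>.\<close>
  then have "connected (f ` I)"
    using I(1) by (intro connected_continuous_image is_interval_connected)
  moreover have "f ` I \<subseteq> {1, -1}"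
    using f by (auto simp: power2_eq_1_iff)
  then have "finite (f ` I)"
    by (rule finite_subset) simp
  moreover have "f ` I \<noteq> {}"
    using I(2) interior_subset by blast
  ultimately obtain e where e: "f ` I = {e}"
    using connected_finite_iff_sing[of "f ` I"] by blast
  then have "f s = e" if "s \<in> I" for s
    using that by blast
  moreover obtain s where "s \<in> I"
    using e by blast
  ultimately show ?thesis
    using f by metis
qed

text \<open>\<open>slant_helix\<close> hides its frame behind an existential; this allows the test
  to be made in any frame at hand. Passing to another frame keeps the axis \<open>U\<close> and at
  most flips the sign of the constant.\<close>

lemma slant_helix_iff_frenet_apparatus:
  assumes I: "is_interval I" "interior I \<noteq> {}"
    and F: "frenet_apparatus I \<alpha> T N B \<kappa> \<tau>"
  shows "slant_helix I \<alpha> \<longleftrightarrow> (\<exists>U c. U \<noteq> 0 \<and> (\<forall>s\<in>I. lorentz_inner (N s) U = c))"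
proof
  assume "slant_helix I \<alpha>"
  then obtain T' N' B' \<kappa>' \<tau>' U c where F': "frenet_apparatus I \<alpha> T' N' B' \<kappa>' \<tau>'"
    and U: "U \<noteq> 0" "\<forall>s\<in>I. lorentz_inner (N' s) U = c"
    unfolding slant_helix_def by blast
  obtain e where "\<forall>s\<in>I. N s = e *\<^sub>R N' s"
    using frenet_apparatus_normal_unique[OF I F' F] by blast
  then have "\<forall>s\<in>I. lorentz_inner (N s) U = e * c"
    using U by (simp add: lorentz_inner_scaleR_left)
  then show "\<exists>U c. U \<noteq> 0 \<and> (\<forall>s\<in>I. lorentz_inner (N s) U = c)"
    using U by blast
next
  assume "\<exists>U c. U \<noteq> 0 \<and> (\<forall>s\<in>I. lorentz_inner (N s) U = c)"
  then show "slant_helix I \<alpha>"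
    unfolding slant_helix_def using F by blast
qed

text \<open>The Bertrand relation supplies frames of both curves with the same normal field, so the
  same \<open>U\<close> and \<open>c\<close> serve for both.\<close>

lemma bertrand_direction_curve_slant_helix_iff:
  assumes I: "is_interval I" "interior I \<noteq> {}"
    and "bertrand_direction_curve I \<alpha> \<beta>"
  shows "slant_helix I \<alpha> \<longleftrightarrow> slant_helix I \<beta>"
proof -
  obtain T N B \<kappa> \<tau> T' N' B' \<kappa>' \<tau>' where F: "frenet_apparatus I \<alpha> T N B \<kappa> \<tau>"
    and F': "frenet_apparatus I \<beta> T' N' B' \<kappa>' \<tau>'" and N: "\<forall>s\<in>I. N' s = N s"
    using assms(3) unfolding bertrand_direction_curve_def by blast
  show ?thesis
    unfolding slant_helix_iff_frenet_apparatus[OF I F] slant_helix_iff_frenet_apparatus[OF I F']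
    using N by simp
qed

theorem theorem5p5:
  fixes I :: "real set" and \<alpha> \<beta> :: "real \<Rightarrow> real^3"
  assumes "is_interval I" and "interior I \<noteq> {}"
    and "nonlightlike_curve I \<alpha>" and "frenet_curve I \<alpha>"
    and "nonlightlike_curve I \<beta>" and "frenet_curve I \<beta>"
    and "bertrand_direction_curve I \<alpha> \<beta>"
  shows "(slant_helix I \<alpha> \<longleftrightarrow> (\<exists>\<gamma>. slant_helix I \<gamma> \<and> bertrand_donor_curve I \<gamma> \<alpha>))
       \<and> (slant_helix I \<alpha> \<longleftrightarrow> (\<exists>\<gamma>. bertrand_direction_curve I \<alpha> \<gamma> \<and> slant_helix I \<gamma>))
       \<and> (slant_helix I \<alpha> \<longleftrightarrow> slant_helix I \<beta>)"
  \<comment> \<open>In the forward directions \<open>\<beta>\<close> is the witness for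
    \<open>\<gamma>\<close>; in the backward ones the preceding lemma is applied to the given
    \<open>\<gamma>\<close>.\<close>
  unfolding bertrand_donor_curve_def
  using bertrand_direction_curve_slant_helix_iff[OF assms(1,2)] assms(7) by blast

end
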